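(* For all integers $n$ and $k$ with $4\leq k\leq \frac{n}{3}$, any comparison-based algorithm that, given a permutation of $\{1,\ldots,n\}$, computes the length of its longest subsequence that is a $k$-rollercoaster performs at least $\Omega(n\log k)$ comparisons (in the worst case).
   Context: A subsequence of a sequence $(S[1],\dots,S[n])$ is a sequence $(S[i_1],\dots,S[i_m])$ with $1\le i_1<\dots<i_m\le n$. A run of a sequence is a maximal contiguous subsequence that is increasing or decreasing. For $k\geq 3$, a $k$-rollercoaster is a sequence of numbers every run of which has length at least $k$. A comparison-based algorithm accesses the input only by comparing pairs of its elements. *)

theory Defs
  imports Complex_Main "HOL-Library.Sublist" "HOL-Combinatorics.Multiset_Permutations"
begin

definition monotone_seq :: "'a::linorder list \<Rightarrow> bool" where
  "monotone_seq xs \<longleftrightarrow> sorted_wrt (<) xs \<or> sorted_wrt (>) xs"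

definition segment :: "'a list \<Rightarrow> nat \<Rightarrow> nat \<Rightarrow> 'a list" where
  "segment xs i j = take (j - i) (drop i xs)"

text \<open>Runs are nonempty and are identified by their positions \<open>i, \<dots>, j - 1\<close> (counted from 0),
  so maximality is maximality among the segments that cover these positions.\<close>

definition is_run :: "'a::linorder list \<Rightarrow> nat \<Rightarrow> nat \<Rightarrow> bool" where
  "is_run xs i j \<longleftrightarrow> i < j \<and> j \<le> length xs \<and> monotone_seq (segment xs i j) \<and>
     (\<forall>i' j'. i' \<le> i \<and> j \<le> j' \<and> j' \<le> length xs \<and> monotone_seq (segment xs i' j')
        \<longrightarrow> i' = i \<and> j' = j)"

definition rollercoaster :: "nat \<Rightarrow> 'a::linorder list \<Rightarrow> bool" where
  "rollercoaster k xs \<longleftrightarrow> (\<forall>i j. is_run xs i j \<longrightarrow> k \<le> j - i)"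

text \<open>The empty sequence has no runs, so it is a \<open>k\<close>-rollercoaster; a sequence without any
  nonempty \<open>k\<close>-rollercoaster as a subsequence therefore gets the value 0.\<close>

definition longest_rollercoaster :: "nat \<Rightarrow> 'a::linorder list \<Rightarrow> nat" where
  "longest_rollercoaster k xs = Max {length ys | ys. subseq ys xs \<and> rollercoaster k ys}"

text \<open>On inputs of a fixed length, a deterministic comparison-based algorithm is a binary decision
  tree: \<open>Compare i j l r\<close> asks whether the input element at position \<open>i\<close> is smaller than the one
  at position \<open>j\<close>, and proceeds with \<open>l\<close> if so and with \<open>r\<close> otherwise.\<close>

datatype 'r comparison_tree =
    Answer 'r
  | Compare nat nat "'r comparison_tree" "'r comparison_tree"

text \<open>Without this restriction a tree could compare an input element with the fixed value that
  \<open>(!)\<close> has outside the list.\<close>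

primrec well_formed :: "nat \<Rightarrow> 'r comparison_tree \<Rightarrow> bool" where
  "well_formed n (Answer v) \<longleftrightarrow> True"
| "well_formed n (Compare i j l r) \<longleftrightarrow> i < n \<and> j < n \<and> well_formed n l \<and> well_formed n r"

primrec answer :: "'r comparison_tree \<Rightarrow> 'a::linorder list \<Rightarrow> 'r" where
  "answer (Answer v) S = v"
| "answer (Compare i j l r) S = (if S ! i < S ! j then answer l S else answer r S)"

primrec comparisons :: "'r comparison_tree \<Rightarrow> 'a::linorder list \<Rightarrow> nat" where
  "comparisons (Answer v) S = 0"
| "comparisons (Compare i j l r) S =
     Suc (if S ! i < S ! j then comparisons l S else comparisons r S)"

definition computes_longest_rollercoaster :: "nat \<Rightarrow> nat \<Rightarrow> nat comparison_tree \<Rightarrow> bool" where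
  "computes_longest_rollercoaster n k T \<longleftrightarrow> well_formed n T \<and>
     (\<forall>S \<in> permutations_of_set {1..n}. answer T S = longest_rollercoaster k S)"

definition worst_case_comparisons :: "nat \<Rightarrow> 'r comparison_tree \<Rightarrow> nat" where
  "worst_case_comparisons n T = Max (comparisons T ` permutations_of_set {1..n})"

end

theory Submission
  imports Defs
begin

text \<open>Consider a word over the letters \<open>0, \<dots>, M - 1\<close> and the permutation that orders the
  positions by their letters, equal letters from right to left. Its longest increasing subsequence
  has length at most \<open>M\<close>, and if weakly decreasing subsequences of the word are shorter than \<open>k\<close>,
  then a \<open>k\<close>-rollercoaster in the permutation has no decreasing run, so it has length at most \<open>M\<close>
  as well. Suppose that the first occurrences of the letters form an increasing chain of
  positions, and so do the last occurrences. Exchanging two adjacent occurrences of a letter then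
  creates an increasing subsequence of length \<open>M + 1\<close>, so every correct tree compares them.
  Consequently, if two such words \<open>u\<close>, \<open>v\<close> with the same first and last occurrences
  follow the same path, then \<open>v\<close> is weakly decreasing on the positions of each letter \<open>a\<close> of \<open>u\<close>;
  as it equals \<open>a\<close> on the first and the last of them, \<open>u = v\<close>. So different words end in
  different leaves.

  With \<open>w = (k - 1) div 3\<close> we use about \<open>n / (3 w)\<close> consecutive blocks, each consisting of its
  own \<open>w\<close> letters in increasing order, an arbitrary word of length \<open>w\<close> over them, and the \<open>w\<close>
  letters again. Each decreasing run stays within one block, so it is shorter than \<open>k\<close>, and
  \<open>M \<ge> n / 3 \<ge> k\<close>, so the increasing subsequence of length \<open>M + 1\<close> is a \<open>k\<close>-rollercoaster. About a
  third of the positions is free with \<open>w\<close> choices each, which gives the bound for \<open>k \<ge> 16\<close>. For smaller \<open>k\<close> the linearly many forced comparisons of adjacent occurrences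
  suffice.\<close>

section \<open>Subsequences, runs and bounds on the longest rollercoaster\<close>

lemma subseq_iff_map_nth:
  "subseq ys xs \<longleftrightarrow> (\<exists>is. sorted_wrt (<) is \<and> set is \<subseteq> {..<length xs} \<and> ys = map ((!) xs) is)"
proof
  assume "subseq ys xs"
  then have "subseq ys (map ((!) xs) [0..<length xs])" by (simp add: map_nth)
  then obtain N where "ys = map ((!) xs) (nths [0..<length xs] N)"
    by (auto simp: subseq_conv_nths nths_map)
  moreover have "subseq (nths [0..<length xs] N) [0..<length xs]"
    by (auto simp: subseq_conv_nths)
  ultimately show "\<exists>is. sorted_wrt (<) is \<and> set is \<subseteq> {..<length xs} \<and> ys = map ((!) xs) is"
    by (intro exI[of _ "nths [0..<length xs] N"])
      (auto dest: in_set_nthsD simp: strict_sorted_iff sorted_nths)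
next
  assume "\<exists>is. sorted_wrt (<) is \<and> set is \<subseteq> {..<length xs} \<and> ys = map ((!) xs) is"
  then obtain js where js: "sorted_wrt (<) js" "set js \<subseteq> {..<length xs}" "ys = map ((!) xs) js"
    by blast
  have "js = filter (\<lambda>i. i \<in> set js) [0..<length xs]"
    using js by (intro sorted_distinct_set_unique) (auto simp: strict_sorted_iff sorted_wrt_filter)
  then have "subseq js [0..<length xs]" by (metis subseq_filter_left)
  then have "subseq ys (map ((!) xs) [0..<length xs])"
    using js(3) by (simp add: subseq_map)
  then show "subseq ys xs" by (simp add: map_nth)
qed

lemma rollercoaster_Nil: "rollercoaster k []"
  by (simp add: rollercoaster_def is_run_def)

lemma rollercoaster_sorted:
  assumes "sorted_wrt (<) ys" "k \<le> length ys"
  shows "rollercoaster k ys"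
  unfolding rollercoaster_def
proof (intro allI impI)
  fix i j assume r: "is_run ys i j"
  have "monotone_seq (segment ys 0 (length ys))"
    using assms by (simp add: monotone_seq_def segment_def)
  with r have "0 = i \<and> length ys = j" unfolding is_run_def by blast
  with assms show "k \<le> j - i" by auto
qed

lemma length_segment: "j \<le> length xs \<Longrightarrow> length (segment xs i j) = j - i"
  by (simp add: segment_def)

lemma nth_segment: "i + t < j \<Longrightarrow> j \<le> length xs \<Longrightarrow> segment xs i j ! t = xs ! (i + t)"
  by (simp add: segment_def)

lemma subseq_segment: "subseq (segment xs i j) xs"
  unfolding segment_def
  by (meson prefix_imp_subseq subseq_order.trans suffix_drop suffix_imp_subseq take_is_prefix)

text \<open>A longest monotone segment among those that cover the given one is maximal.\<close>

lemma monotone_segment_extends_to_run: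
  assumes "i < j" "j \<le> length xs" "monotone_seq (segment xs i j)"
  obtains i' j' where "is_run xs i' j'" "i' \<le> i" "j \<le> j'"
proof -
  let ?P = "\<lambda>(i', j'). i' \<le> i \<and> j \<le> j' \<and> j' \<le> length xs \<and> monotone_seq (segment xs i' j')"
  obtain x where x: "?P x" and max: "\<And>y. ?P y \<Longrightarrow> snd y - fst y \<le> snd x - fst x"
    using ex_has_greatest_nat[of ?P "(i, j)" "\<lambda>y. snd y - fst y" "length xs"] assms by fastforce
  obtain i' j' where xe: "x = (i', j')" by fastforce
  have "is_run xs i' j'"
    unfolding is_run_def
  proof (intro conjI allI impI)
    fix a b assume ab: "a \<le> i' \<and> j' \<le> b \<and> b \<le> length xs \<and> monotone_seq (segment xs a b)"
    then have "b - a \<le> j' - i'" using max[of "(a, b)"] x xe by auto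
    then show "a = i'" "b = j'" using ab x xe assms(1) by auto
  qed (use x xe assms in auto)
  then show thesis using that x xe by auto
qed

text \<open>A list that is not increasing has a descent between neighbours. The run through this
  descent cannot increase, so it decreases, and its length is at least \<open>k\<close>.\<close>

lemma rollercoaster_increasing_or_decreasing_subseq:
  assumes "rollercoaster k ys" "distinct ys"
  obtains "sorted_wrt (<) ys"
  | zs where "subseq zs ys" "sorted_wrt (>) zs" "k \<le> length zs"
proof (cases "sorted_wrt (<) ys")
  case False
  then have "\<not> sorted ys" using assms(2) by (simp add: strict_sorted_iff)
  then obtain i where i: "Suc i < length ys" "ys ! Suc i < ys ! i"
    by (auto simp: sorted_iff_nth_Suc not_le)
  have "segment ys i (Suc (Suc i)) = [ys ! i, ys ! Suc i]"
    using i by (intro nth_equalityI) (auto simp: length_segment nth_segment less_Suc_eq numeral_2_eq_2)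
  then have "monotone_seq (segment ys i (Suc (Suc i)))"
    using i by (simp add: monotone_seq_def)
  then obtain a b where ab: "is_run ys a b" "a \<le> i" "Suc (Suc i) \<le> b"
    using i monotone_segment_extends_to_run[of i "Suc (Suc i)" ys] by auto
  let ?s = "segment ys a b"
  have b: "b \<le> length ys" using ab by (simp add: is_run_def)
  have nth: "?s ! (i - a) = ys ! i" "?s ! Suc (i - a) = ys ! Suc i"
    using ab b by (auto simp: nth_segment)
  have "\<not> sorted_wrt (<) ?s"
  proof
    assume "sorted_wrt (<) ?s"
    then have "?s ! (i - a) < ?s ! Suc (i - a)"
      using ab b by (intro sorted_wrt_nth_less[of "(<)"]) (auto simp: length_segment)
    with nth i show False by simp
  qed
  then have "sorted_wrt (>) ?s" using ab by (auto simp: is_run_def monotone_seq_def)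
  moreover have "k \<le> length ?s" using assms(1) ab b by (simp add: rollercoaster_def length_segment)
  ultimately show thesis using that(2) subseq_segment by blast
qed (use that in blast)

lemma finite_subseq_lengths: "finite {length ys | ys. subseq ys xs \<and> P ys}"
  by (rule finite_subset[of _ "{..length xs}"]) (auto dest: list_emb_length)

lemma longest_rollercoaster_ge:
  assumes "subseq ys xs" "sorted_wrt (<) ys" "k \<le> length ys"
  shows "length ys \<le> longest_rollercoaster k xs"
  unfolding longest_rollercoaster_def
  using assms rollercoaster_sorted by (intro Max_ge finite_subseq_lengths) auto

lemma longest_rollercoaster_le:
  assumes "distinct xs"
    and inc: "\<And>ys. subseq ys xs \<Longrightarrow> sorted_wrt (<) ys \<Longrightarrow> length ys \<le> M"
    and dec: "\<And>ys. subseq ys xs \<Longrightarrow> sorted_wrt (>) ys \<Longrightarrow> length ys < k"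
  shows "longest_rollercoaster k xs \<le> M"
proof -
  have "length ys \<le> M" if ys: "subseq ys xs" "rollercoaster k ys" for ys
  proof -
    have "distinct ys" using ys(1) assms(1) by (auto simp: subseq_conv_nths distinct_nthsI)
    with ys(2) show ?thesis
    proof (cases rule: rollercoaster_increasing_or_decreasing_subseq)
      case 1
      then show ?thesis using inc ys(1) by blast
    next
      case (2 zs)
      then have "length zs < k" using dec ys(1) subseq_order.trans by blast
      with 2 show ?thesis by simp
    qed
  qed
  then show ?thesis unfolding longest_rollercoaster_def
    using rollercoaster_Nil by (intro Max.boundedI finite_subseq_lengths) (auto intro!: exI[of _ "[]"])
qed

section \<open>Paths of decision trees, compared pairs and counting of leaves\<close>

primrec path :: "'r comparison_tree \<Rightarrow> 'a::linorder list \<Rightarrow> bool list" where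
  "path (Answer v) S = []"
| "path (Compare i j l r) S = (S ! i < S ! j) # (if S ! i < S ! j then path l S else path r S)"

primrec compared :: "'r comparison_tree \<Rightarrow> 'a::linorder list \<Rightarrow> (nat \<times> nat) set" where
  "compared (Answer v) S = {}"
| "compared (Compare i j l r) S =
     insert (i, j) (if S ! i < S ! j then compared l S else compared r S)"

lemma compared_well_formed: "well_formed n T \<Longrightarrow> compared T S \<subseteq> {..<n} \<times> {..<n}"
  by (induction T) auto

lemma card_compared: "card (compared T S) \<le> comparisons T S" "finite (compared T S)"
proof (induction T)
  case (Compare i j l r)
  { case 1 then show ?case using Compare by (auto intro: card_insert_le_m1 order.trans[OF card_insert_le_m1]) }
  { case 2 then show ?case using Compare by auto }
qed auto

text \<open>The adversary principle: changing the order of pairs that were not compared leaves the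
  output as it is.\<close>

lemma answer_cong:
  assumes "\<And>i j. (i, j) \<in> compared T S \<Longrightarrow> (S ! i < S ! j) = (S' ! i < S' ! j)"
  shows "answer T S = answer T S'"
  using assms by (induction T) auto

lemma path_eqD:
  "path T S = path T S' \<Longrightarrow> (i, j) \<in> compared T S \<Longrightarrow> (S ! i < S ! j) = (S' ! i < S' ! j)"
  by (induction T) (auto split: if_splits)

text \<open>The root splits \<open>F\<close> by the outcome of its comparison, and each half has one
  comparison less to spend. The bound \<open>d\<close> concerns inputs in \<open>F\<close> only, so
  branches that these never reach may be deeper.\<close>

lemma card_le_if_inj_on_path:
  assumes "finite F" "inj_on (path T) F" "\<And>S. S \<in> F \<Longrightarrow> comparisons T S \<le> d"
  shows "card F \<le> 2 ^ d"
  using assms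
proof (induction T arbitrary: F d)
  case (Answer v)
  then have "card F \<le> 1" by (auto simp: card_le_Suc0_iff_eq inj_on_def)
  then show ?case by (meson one_le_numeral one_le_power order.trans)
next
  case (Compare i j l r)
  show ?case
  proof (cases d)
    case 0
    then have "F = {}" using Compare.prems(3) by fastforce
    then show ?thesis by simp
  next
    case (Suc e)
    let ?L = "{S \<in> F. S ! i < S ! j}" and ?R = "{S \<in> F. \<not> S ! i < S ! j}"
    have "card ?L \<le> 2 ^ e"
      using Compare.prems Suc by (intro Compare.IH(1)) (fastforce simp: inj_on_def)+
    moreover have "card ?R \<le> 2 ^ e"
      using Compare.prems Suc by (intro Compare.IH(2)) (fastforce simp: inj_on_def)+
    moreover have "card F = card ?L + card ?R"
      using Compare.prems(1) by (subst card_Un_disjoint[symmetric]) (auto intro: arg_cong[of _ _ card])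
    ultimately show ?thesis using Suc by simp
  qed
qed

section \<open>Permutations from injective keys\<close>

text \<open>Replacing keys by their ranks keeps all comparison outcomes, so inputs can be described
  by any convenient injective key.\<close>

definition rank_list :: "nat \<Rightarrow> (nat \<Rightarrow> 'a::linorder) \<Rightarrow> nat list" where
  "rank_list n f = map (\<lambda>p. card {q \<in> {..<n}. f q \<le> f p}) [0..<n]"

lemma length_rank_list [simp]: "length (rank_list n f) = n"
  by (simp add: rank_list_def)

lemma rank_list_less_iff:
  assumes "p < n" "q < n"
  shows "rank_list n f ! p < rank_list n f ! q \<longleftrightarrow> f p < f q"
proof -
  have less: "card {r \<in> {..<n}. f r \<le> f x} < card {r \<in> {..<n}. f r \<le> f y}" if "f x < f y" "y < n" for x y
    using that by (intro psubset_card_mono) (auto dest: leD)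
  have "card {r \<in> {..<n}. f r \<le> f q} \<le> card {r \<in> {..<n}. f r \<le> f p}" if "f q \<le> f p"
    using that by (intro card_mono) auto
  then show ?thesis using assms less[of p q] by (fastforce simp: rank_list_def not_less[symmetric])
qed

lemma rank_list_permutation:
  assumes "inj_on f {..<n}"
  shows "rank_list n f \<in> permutations_of_set {1..n}"
proof -
  have eq: "rank_list n f ! p = rank_list n f ! q \<longleftrightarrow> p = q" if "p < n" "q < n" for p q
    using that assms rank_list_less_iff[of p n q f] rank_list_less_iff[of q n p f]
    by (metis inj_onD lessThan_iff less_irrefl linorder_neqE)
  then have d: "distinct (rank_list n f)" by (simp add: distinct_conv_nth)
  have "set (rank_list n f) \<subseteq> {1..n}"
  proof
    fix x assume "x \<in> set (rank_list n f)"
    then obtain p where p: "p < n" "x = card {q \<in> {..<n}. f q \<le> f p}"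
      by (auto simp: rank_list_def)
    have "x \<noteq> 0" using p by (auto simp: card_eq_0_iff)
    moreover have "x \<le> card {..<n}" unfolding p(2) by (rule card_mono) auto
    ultimately show "x \<in> {1..n}" by auto
  qed
  then have "set (rank_list n f) = {1..n}"
    using d by (intro card_subset_eq) (auto simp: distinct_card)
  with d show ?thesis by (simp add: permutations_of_set_def)
qed

section \<open>Layered words and the comparisons they force\<close>

lemma adjacent_occurrence:
  fixes f :: "nat \<Rightarrow> 'a"
  assumes "r < p" "f r = f p"
  obtains q where "r \<le> q" "q < p" "f q = f p" "\<And>s. q < s \<Longrightarrow> s < p \<Longrightarrow> f s \<noteq> f p"
proof -
  let ?A = "{q. q < p \<and> f q = f p}"
  have "finite ?A" "r \<in> ?A" using assms by auto
  moreover from this have "Max ?A \<in> ?A" by (intro Max_in) auto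
  ultimately have "Max ?A \<in> ?A" "r \<le> Max ?A" "\<And>s. s \<in> ?A \<Longrightarrow> s \<le> Max ?A" by auto
  then show thesis using that[of "Max ?A"] by fastforce
qed

text \<open>\<open>lo\<close> and \<open>hi\<close> give the first and last occurrences. They are
  parameters, not derived from \<open>letter\<close>, so that several words can share them.
  \<open>descent_less\<close> excludes long decreasing runs; \<open>k_le\<close> makes an increasing
  list of length \<open>M + 1\<close> a \<open>k\<close>-rollercoaster.\<close>

locale layered_word =
  fixes n M k :: nat and lo hi letter :: "nat \<Rightarrow> nat"
  assumes letter_less: "p < n \<Longrightarrow> letter p < M"
    and lo: "a < M \<Longrightarrow> lo a < n" "a < M \<Longrightarrow> letter (lo a) = a"
    and hi: "a < M \<Longrightarrow> hi a < n" "a < M \<Longrightarrow> letter (hi a) = a"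
    and lo_mono: "a < b \<Longrightarrow> b < M \<Longrightarrow> lo a < lo b"
    and hi_mono: "a < b \<Longrightarrow> b < M \<Longrightarrow> hi a < hi b"
    and lo_le: "p < n \<Longrightarrow> lo (letter p) \<le> p"
    and le_hi: "p < n \<Longrightarrow> p \<le> hi (letter p)"
    and descent_less: "sorted_wrt (<) ps \<Longrightarrow> set ps \<subseteq> {..<n} \<Longrightarrow>
      sorted_wrt (\<ge>) (map letter ps) \<Longrightarrow> length ps < k"
    and k_le: "k \<le> M"
begin

text \<open>A number in base \<open>n\<close> with leading digit the letter and last digit the
  reversed position, so the order is lexicographic.\<close>

definition key :: "nat \<Rightarrow> nat" where
  "key p = letter p * n + (n - Suc p)"

definition perm :: "nat list" where
  "perm = rank_list n key"

lemma key_less_iff: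
  assumes "p < n" "q < n"
  shows "key p < key q \<longleftrightarrow> letter p < letter q \<or> letter p = letter q \<and> q < p"
proof -
  have *: "key x < key y" if "letter x < letter y" "x < n" for x y
  proof -
    have "Suc (letter x) * n \<le> letter y * n" using that by (intro mult_le_mono1) simp
    then show ?thesis using that by (simp add: key_def)
  qed
  show ?thesis
    using *[of p q] *[of q p] assms
    by (cases "letter p" "letter q" rule: linorder_cases) (auto simp: key_def)
qed

lemma inj_on_key: "inj_on key {..<n}"
proof (rule inj_onI)
  fix p q assume "p \<in> {..<n}" "q \<in> {..<n}" "key p = key q"
  then show "p = q"
    using key_less_iff[of p q] key_less_iff[of q p] by (metis lessThan_iff linorder_neqE_nat less_irrefl)
qed

lemma length_perm [simp]: "length perm = n"
  by (simp add: perm_def)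

lemma perm_less_iff:
  "p < n \<Longrightarrow> q < n \<Longrightarrow>
    perm ! p < perm ! q \<longleftrightarrow> letter p < letter q \<or> letter p = letter q \<and> q < p"
  by (simp add: perm_def rank_list_less_iff key_less_iff)

lemma perm_permutation: "perm \<in> permutations_of_set {1..n}"
  unfolding perm_def by (intro rank_list_permutation inj_on_key)

text \<open>Equal letters have falling values from left to right, so an increasing subsequence uses
  each letter at most once, while the letters along a decreasing one fall weakly.\<close>

lemma longest_rollercoaster_perm: "longest_rollercoaster k perm \<le> M"
proof (rule longest_rollercoaster_le)
  show "distinct perm" using perm_permutation by (simp add: permutations_of_set_def)
next
  fix ys assume "subseq ys perm" and inc: "sorted_wrt (<) ys"
  then obtain js where js: "sorted_wrt (<) js" "set js \<subseteq> {..<n}" "ys = map ((!) perm) js"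
    by (auto simp: subseq_iff_map_nth)
  have "sorted_wrt (<) (map letter js)"
    unfolding sorted_wrt_iff_nth_less
  proof (intro allI impI)
    fix i j assume ij: "i < j" "j < length (map letter js)"
    have "js ! i < js ! j" "perm ! (js ! i) < perm ! (js ! j)"
      using ij js inc by (auto simp: sorted_wrt_iff_nth_less)
    moreover have "js ! i \<in> set js" "js ! j \<in> set js" using ij by simp_all
    then have "js ! i < n" "js ! j < n" using js(2) by auto
    ultimately show "map letter js ! i < map letter js ! j"
      using ij by (auto simp: perm_less_iff)
  qed
  then have "length js = card (set (map letter js))"
    by (metis distinct_card length_map strict_sorted_iff)
  also have "\<dots> \<le> card {..<M}" using js letter_less by (intro card_mono) auto
  finally show "length ys \<le> M" using js by simp
next
  fix ys assume "subseq ys perm" and dec: "sorted_wrt (>) ys"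
  then obtain js where js: "sorted_wrt (<) js" "set js \<subseteq> {..<n}" "ys = map ((!) perm) js"
    by (auto simp: subseq_iff_map_nth)
  have "sorted_wrt (\<ge>) (map letter js)"
    unfolding sorted_wrt_iff_nth_less
  proof (intro allI impI)
    fix i j assume ij: "i < j" "j < length (map letter js)"
    have "perm ! (js ! i) > perm ! (js ! j)"
      using ij js dec by (auto simp: sorted_wrt_iff_nth_less)
    moreover have "js ! i \<in> set js" "js ! j \<in> set js" using ij by simp_all
    then have "js ! i < n" "js ! j < n" using js(2) by auto
    ultimately show "map letter js ! i \<ge> map letter js ! j"
      using ij by (auto simp: perm_less_iff)
  qed
  then show "length ys < k" using descent_less js by simp
qed

text \<open>Exchanging two adjacent occurrences \<open>q < p\<close> of the letter \<open>a\<close> makes the positions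
  \<open>lo 0, \<dots>, lo (a - 1), q, p, hi (a + 1), \<dots>, hi (M - 1)\<close> increasing, and no comparison other
  than that of \<open>p\<close> and \<open>q\<close> notices the exchange.\<close>

lemma adjacent_occurrences_compared:
  assumes T: "computes_longest_rollercoaster n k T"
    and qp: "q < p" "p < n" "letter q = letter p" "\<And>r. q < r \<Longrightarrow> r < p \<Longrightarrow> letter r \<noteq> letter p"
  shows "(p, q) \<in> compared T perm \<or> (q, p) \<in> compared T perm"
proof (rule ccontr)
  assume not: "\<not> ?thesis"
  define f where "f = key \<circ> transpose q p"
  define S where "S = rank_list n f"
  define a where "a = letter p"
  have a: "a < M" using letter_less qp by (simp add: a_def)
  have f: "f q = key p" "f p = key q" "\<And>r. r \<noteq> p \<Longrightarrow> r \<noteq> q \<Longrightarrow> f r = key r"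
    by (auto simp: f_def)
  have "transpose q p ` {..<n} = {..<n}" using qp by (simp add: transpose_image_eq)
  then have "inj_on f {..<n}"
    unfolding f_def using inj_on_key by (intro comp_inj_on) (auto intro: inj_onI dest: transpose_eq_imp_eq)
  then have S: "S \<in> permutations_of_set {1..n}"
    unfolding S_def by (rule rank_list_permutation)
  have S_less: "S ! i < S ! j \<longleftrightarrow> f i < f j" if "i < n" "j < n" for i j
    using that by (simp add: S_def rank_list_less_iff)
  have "answer T perm = answer T S"
  proof (rule answer_cong)
    fix i j assume ij: "(i, j) \<in> compared T perm"
    have n: "i < n" "j < n"
      using compared_well_formed[of n T perm] T ij by (auto simp: computes_longest_rollercoaster_def)
    have ne: "(i, j) \<noteq> (p, q)" "(i, j) \<noteq> (q, p)" using ij not by auto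
    \<comment> \<open>No key lies strictly between those of \<open>p\<close> and \<open>q\<close>:
      its position would carry the same letter and lie between these adjacent occurrences.\<close>
    have 1: "key r < key p \<longleftrightarrow> key r < key q" "key p < key r \<longleftrightarrow> key q < key r"
      if "r < n" "r \<noteq> p" "r \<noteq> q" for r
      using that qp by (auto simp: key_less_iff) (metis linorder_neqE_nat)+
    have "f i < f j \<longleftrightarrow> key i < key j"
    proof (cases "i = j")
      case False
      then consider "i \<notin> {p, q}" "j \<notin> {p, q}" | "i \<in> {p, q}" "j \<notin> {p, q}" | "i \<notin> {p, q}" "j \<in> {p, q}"
        using ne by blast
      then show ?thesis
        using n f 1[of i] 1[of j] by cases auto
    qed simp
    then show "perm ! i < perm ! j \<longleftrightarrow> S ! i < S ! j"
      using n S_less by (simp add: perm_def rank_list_less_iff)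
  qed
  then have eq: "longest_rollercoaster k S = longest_rollercoaster k perm"
    using T S perm_permutation by (simp add: computes_longest_rollercoaster_def)
  define js where "js = map lo [0..<a] @ [q, p] @ map hi [Suc a..<M]"
  have lo_q: "lo b < q" if "b < a" for b
    using lo_mono[OF that a] lo_le[of q] qp by (simp add: a_def)
  have hi_p: "p < hi b" if "a < b" "b < M" for b
    using hi_mono[OF that] le_hi[of p] qp by (simp add: a_def)
  \<comment> \<open>The exchange is within one letter, so \<open>f\<close> still orders different
    letters correctly.\<close>
  have f_less: "f x < f y" if "x < n" "y < n" "letter x < letter y" for x y
    using that qp by (cases "x = p"; cases "x = q"; cases "y = p"; cases "y = q")
      (auto simp: f key_less_iff)
  have set: "set js \<subseteq> {..<n}" using lo hi qp a by (auto simp: js_def)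
  \<comment> \<open>\<open>R\<close> joins the order of positions and that of values, so that one
    sortedness proof yields both the subsequence and its increase.\<close>
  define R where "R i j \<longleftrightarrow> i < j \<and> f i < f j" for i j
  have R: "R (lo b) (lo c)" if "b < c" "c < a" for b c
    using that a by (auto simp: R_def lo_mono lo intro!: f_less)
  have R': "R (hi b) (hi c)" if "a < b" "b < c" "c < M" for b c
    using that by (auto simp: R_def hi_mono hi intro!: f_less)
  have R_lo: "R (lo b) q" "R (lo b) p" if "b < a" for b
    using that a qp lo_q[OF that] by (auto simp: R_def lo a_def[symmetric] intro!: f_less)
  have R_hi: "R q (hi b)" "R p (hi b)" if "a < b" "b < M" for b
    using that a qp hi_p[OF that] by (auto simp: R_def hi a_def[symmetric] intro!: f_less)
  have R_lo_hi: "R (lo b) (hi c)" if "b < a" "a < c" "c < M" for b c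
    using R_lo(1)[of b] R_hi(1)[of c] that by (simp add: R_def)
  have R_qp: "R q p" using qp by (simp add: R_def f key_less_iff)
  have "sorted_wrt R (map lo [0..<a])" "sorted_wrt R (map hi [Suc a..<M])"
    using R R' by (simp_all add: sorted_wrt_iff_nth_less)
  then have js: "sorted_wrt R js"
    using R_lo R_hi R_lo_hi R_qp by (auto simp: js_def sorted_wrt_append)
  have "subseq (map ((!) S) js) S"
    unfolding subseq_iff_map_nth
    using js set by (intro exI[of _ js]) (auto simp: S_def R_def elim: sorted_wrt_mono_rel[rotated])
  moreover have "sorted_wrt (<) (map ((!) S) js)"
    unfolding sorted_wrt_map using set js by (auto simp: S_less R_def elim!: sorted_wrt_mono_rel[rotated])
  moreover have "length js = Suc M" using a by (simp add: js_def)
  ultimately have "Suc M \<le> longest_rollercoaster k S"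
    using longest_rollercoaster_ge[of "map ((!) S) js" S k] k_le by simp
  then show False using eq longest_rollercoaster_perm by simp
qed

text \<open>Each position that is not a first occurrence is the larger end of a compared pair of
  adjacent occurrences, and there are only \<open>M\<close> first occurrences.\<close>

lemma comparisons_perm_ge:
  assumes "computes_longest_rollercoaster n k T"
  shows "n \<le> M + comparisons T perm"
proof -
  have "{..<n} \<subseteq> lo ` {..<M} \<union> (\<lambda>(i, j). max i j) ` compared T perm"
  proof
    fix p assume p: "p \<in> {..<n}"
    show "p \<in> lo ` {..<M} \<union> (\<lambda>(i, j). max i j) ` compared T perm"
    proof (cases "lo (letter p) = p")
      case True
      then show ?thesis using p letter_less by (metis UnI1 imageI lessThan_iff)
    next
      case False
      then have "lo (letter p) < p" using lo_le p by (simp add: order_less_le)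
      moreover have "letter (lo (letter p)) = letter p" using lo letter_less p by simp
      ultimately obtain q where "q < p" "letter q = letter p" "\<And>r. q < r \<Longrightarrow> r < p \<Longrightarrow> letter r \<noteq> letter p"
        by (rule adjacent_occurrence) blast
      then show ?thesis using adjacent_occurrences_compared[OF assms, of q p] p by force
    qed
  qed
  then have "card {..<n} \<le> card (lo ` {..<M} \<union> (\<lambda>(i, j). max i j) ` compared T perm)"
    by (intro card_mono) (auto simp: card_compared)
  also have "\<dots> \<le> card (lo ` {..<M}) + card ((\<lambda>(i, j). max i j) ` compared T perm)"
    by (rule card_Un_le)
  also have "\<dots> \<le> M + comparisons T perm"
    by (intro add_mono) (metis card_image_le card_lessThan finite_lessThan,
      metis card_image_le card_compared order.trans)
  finally show ?thesis by simp
qed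

end

section \<open>Recovering a word from its path\<close>

lemma path_perm_eqD:
  assumes "layered_word n M k lo hi u" "layered_word n M k lo hi v"
    and T: "computes_longest_rollercoaster n k T"
    and path: "path T (layered_word.perm n u) = path T (layered_word.perm n v)"
    and "p < n"
  shows "u p = v p"
proof -
  interpret u: layered_word n M k lo hi u by fact
  interpret v: layered_word n M k lo hi v by fact
  \<comment> \<open>The tree compares adjacent occurrences of a letter of \<open>u\<close> and finds
    the later one smaller. The same outcome for \<open>v\<close> means that its letter does not rise
    there; the induction chains these steps.\<close>
  have mono: "v p \<le> v q" if "q \<le> p" "p < n" "u q = u p" for q p
    using that
  proof (induction p rule: less_induct)
    case (less p)
    show ?case
    proof (cases "q = p")
      case False
      then have "q < p" using less.prems by simp
      then obtain r where r: "q \<le> r" "r < p" "u r = u p" "\<And>s. r < s \<Longrightarrow> s < p \<Longrightarrow> u s \<noteq> u p"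
        using less.prems adjacent_occurrence by metis
      have "(p, r) \<in> compared T u.perm \<or> (r, p) \<in> compared T u.perm"
        using u.adjacent_occurrences_compared T r less.prems by blast
      then have "v p \<le> v r"
        using path_eqD[OF path, of p r] path_eqD[OF path, of r p] r less.prems
        by (auto simp: u.perm_less_iff v.perm_less_iff)
      also have "v r \<le> v q" using less.IH[of r] less.prems r by simp
      finally show ?thesis .
    qed simp
  qed
  have a: "u p < M" using u.letter_less \<open>p < n\<close> by simp
  \<comment> \<open>Both words have the letter \<open>u p\<close> at \<open>lo (u p)\<close> and
    \<open>hi (u p)\<close>, which squeezes \<open>v p\<close>.\<close>
  have "v p \<le> v (lo (u p))"
    using mono u.lo[OF a] u.lo_le \<open>p < n\<close> by simp
  moreover have "v (hi (u p)) \<le> v p"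
    using mono u.hi[OF a] u.le_hi \<open>p < n\<close> by simp
  ultimately show ?thesis using v.lo[OF a] v.hi[OF a] by simp
qed

section \<open>The block words and their layered structure\<close>

text \<open>Each of the \<open>m\<close> blocks has \<open>3 * w\<close> positions, and
  \<open>h\<close> fills its middle third. The remaining positions carry new letters in increasing
  order, once each, so \<open>n - 2 * w * m\<close> letters occur in all.\<close>

definition block_word :: "nat \<Rightarrow> nat \<Rightarrow> (nat \<Rightarrow> nat) \<Rightarrow> nat \<Rightarrow> nat" where
  "block_word w m h p =
    (if p < 3 * w * m
     then let i = p div (3 * w); s = p mod (3 * w)
       in w * i + (if s < w then s else if s < 2 * w then h (w * i + (s - w)) else s - 2 * w)
     else p - 2 * w * m)"

definition block_lo :: "nat \<Rightarrow> nat \<Rightarrow> nat \<Rightarrow> nat" where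
  "block_lo w m a = (if a < w * m then 3 * w * (a div w) + a mod w else a + 2 * w * m)"

definition block_hi :: "nat \<Rightarrow> nat \<Rightarrow> nat \<Rightarrow> nat" where
  "block_hi w m a = (if a < w * m then 3 * w * (a div w) + 2 * w + a mod w else a + 2 * w * m)"

lemma block_word_in_block:
  assumes "i < m" "s < 3 * w"
  shows "block_word w m h (3 * w * i + s) =
    w * i + (if s < w then s else if s < 2 * w then h (w * i + (s - w)) else s - 2 * w)"
proof -
  have "3 * w * i + s < 3 * w * Suc i" using assms by simp
  also have "\<dots> \<le> 3 * w * m" using assms by (intro mult_le_mono2) simp
  finally show ?thesis using assms by (simp add: block_word_def Let_def)
qed

lemma block_position_less:
  fixes i m s b :: nat
  assumes "i < m" "s < b"
  shows "b * i + s < b * m"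
proof -
  have "b * i + s < b * Suc i" using assms by simp
  also have "\<dots> \<le> b * m" using assms by (intro mult_le_mono2) simp
  finally show ?thesis .
qed

lemma block_position_cases:
  fixes p b m :: nat
  assumes "p < b * m"
  obtains i s where "i < m" "s < b" "p = b * i + s"
proof
  show "p div b < m" using assms by (simp add: less_mult_imp_div_less mult.commute)
  show "p mod b < b" using assms by (cases b) auto
  show "p = b * (p div b) + p mod b" by simp
qed

lemma layered_block_word:
  assumes w: "0 < w" "3 * w < k" and n: "3 * w * m \<le> n" "n < 3 * w * Suc m" "3 * k \<le> n"
    and h: "\<And>x. x < w * m \<Longrightarrow> h x < w"
  shows "layered_word n (n - 2 * w * m) k (block_lo w m) (block_hi w m) (block_word w m h)"
proof -
  let ?l = "block_word w m h"
  have mid: "h (w * i + (s - w)) < w" if "i < m" "w \<le> s" "s < 2 * w" for i s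
    using h block_position_less[of i m "s - w" w] that by simp
  \<comment> \<open>The letter with index \<open>t\<close> in its block has its outer copies at
    offsets \<open>t\<close> and \<open>2 * w + t\<close>; every occurrence lies between
    them.\<close>
  have in_block: "\<exists>t<w. ?l (3 * w * i + s) = w * i + t \<and> t \<le> s \<and> s \<le> 2 * w + t"
    if "i < m" "s < 3 * w" for i s
    using that mid[of i s] block_word_in_block[of i m s w h] by auto
  have lo_hi_block: "block_lo w m (w * i + t) = 3 * w * i + t"
    "block_hi w m (w * i + t) = 3 * w * i + (2 * w + t)" if "i < m" "t < w" for i t
    using that block_position_less[of i m t w] by (auto simp: block_lo_def block_hi_def)
  have tail: "?l p = p - 2 * w * m" if "3 * w * m \<le> p" for p
    using that by (simp add: block_word_def)
  have div_eq: "?l p div w = p div (3 * w)" if "p < 3 * w * m" for p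
    using that
  proof (cases rule: block_position_cases)
    case (1 i s)
    then show ?thesis using in_block[of i s] w by auto
  qed
  \<comment> \<open>In the tail the block index is \<open>m\<close>, since the tail is shorter than
    a block, and the letters there are at least \<open>w * m\<close>.\<close>
  have div_le: "p div (3 * w) \<le> ?l p div w" if "p < n" for p
  proof (cases "p < 3 * w * m")
    case False
    have "p div (3 * w) < Suc m" using that n by (intro less_mult_imp_div_less) (simp add: mult.commute)
    moreover have "m \<le> ?l p div w" using False w by (simp add: tail less_eq_div_iff_mult_less_eq algebra_simps)
    ultimately show ?thesis by simp
  qed (simp add: div_eq)
  have lo_hi_mono: "block_lo w m a < block_lo w m b \<and> block_hi w m a < block_hi w m b" if ab: "a < b" for a b
  proof (cases "a < w * m")
    case a: True
    then obtain i t where it: "i < m" "t < w" "a = w * i + t" by (rule block_position_cases)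
    show ?thesis
    proof (cases "b < w * m")
      case True
      then obtain j u where ju: "j < m" "u < w" "b = w * j + u" by (rule block_position_cases)
      have "i \<le> j" using ab it ju div_le_mono[of a b w] by simp
      show ?thesis
      proof (cases "i = j")
        case False
        then have "3 * w * Suc i \<le> 3 * w * j" using \<open>i \<le> j\<close> by (intro mult_le_mono2) simp
        then show ?thesis using it ju by (simp add: lo_hi_block)
      qed (use it ju ab in \<open>simp add: lo_hi_block\<close>)
    next
      case False
      have "3 * w * i + (2 * w + t) < 3 * w * m" using it by (intro block_position_less) auto
      also have "\<dots> \<le> b + 2 * w * m" using False by (simp add: algebra_simps)
      finally have "3 * w * i + (2 * w + t) < b + 2 * w * m" .
      moreover have "block_lo w m b = b + 2 * w * m" "block_hi w m b = b + 2 * w * m"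
        using False by (simp_all add: block_lo_def block_hi_def)
      ultimately show ?thesis using it by (simp add: lo_hi_block)
    qed
  qed (use ab in \<open>simp add: block_lo_def block_hi_def\<close>)
  have ends: "block_lo w m a < n \<and> ?l (block_lo w m a) = a \<and> block_hi w m a < n \<and> ?l (block_hi w m a) = a"
    if "a < n - 2 * w * m" for a
  proof (cases "a < w * m")
    case True
    then obtain i t where it: "i < m" "t < w" "a = w * i + t" by (rule block_position_cases)
    then show ?thesis
      using n block_position_less[of i m "2 * w + t" "3 * w"]
        block_word_in_block[of i m t w h] block_word_in_block[of i m "2 * w + t" w h]
      by (simp add: lo_hi_block)
  next
    case False
    then have "3 * w * m \<le> a + 2 * w * m" by (simp add: algebra_simps)
    then have "?l (a + 2 * w * m) = a" by (simp only: tail add_diff_cancel_right')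
    then show ?thesis using False that by (simp add: block_lo_def block_hi_def less_diff_conv)
  qed
  have between: "?l p < n - 2 * w * m \<and> block_lo w m (?l p) \<le> p \<and> p \<le> block_hi w m (?l p)" if "p < n" for p
  proof (cases "p < 3 * w * m")
    case True
    then obtain i s where p: "i < m" "s < 3 * w" "p = 3 * w * i + s" by (rule block_position_cases)
    then obtain t where "t < w" "?l p = w * i + t" "t \<le> s" "s \<le> 2 * w + t" using in_block by blast
    moreover have "w * m \<le> n - 2 * w * m" using n(1) by (simp add: le_diff_conv2 algebra_simps)
    ultimately show ?thesis using p block_position_less[of i m t w] by (simp add: lo_hi_block)
  next
    case False
    then have "3 * w * m \<le> p" by simp
    then have "\<not> p - 2 * w * m < w * m" "2 * w * m \<le> p" by (simp_all add: algebra_simps)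
    then show ?thesis using that False by (simp add: tail block_lo_def block_hi_def)
  qed
  show ?thesis
  proof
    fix ps assume ps: "sorted_wrt (<) ps" "set ps \<subseteq> {..<n}" "sorted_wrt (\<ge>) (map ?l ps)"
    \<comment> \<open>Letters of a later block or of the tail are larger, so a weak descent cannot
      leave its block and has at most \<open>3 * w\<close> positions.\<close>
    have same: "p div (3 * w) = q div (3 * w)" if "p < q" "q < n" "?l q \<le> ?l p" for p q
    proof (rule antisym)
      show "p div (3 * w) \<le> q div (3 * w)" using that by (intro div_le_mono) simp
      show "q div (3 * w) \<le> p div (3 * w)"
      proof (cases "p < 3 * w * m")
        case True
        then show ?thesis using div_le[of q] div_eq[of p] that div_le_mono[of "?l q" "?l p" w] by simp
      next
        case False
        then show ?thesis using that by (simp add: tail)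
      qed
    qed
    show "length ps < k"
    proof (cases ps)
      case (Cons p qs)
      let ?b = "3 * w * (p div (3 * w))"
      have "set ps \<subseteq> {?b..<?b + 3 * w}"
      proof
        fix q assume q: "q \<in> set ps"
        have "q div (3 * w) = p div (3 * w)"
        proof (cases "q = p")
          case False
          then have "p < q" "q < n" "?l q \<le> ?l p" using q ps Cons by auto
          then show ?thesis using same by simp
        qed simp
        then show "q \<in> {?b..<?b + 3 * w}"
          using times_div_less_eq_dividend[of "3 * w" q] dividend_less_times_div[of "3 * w" q] w by simp
      qed
      then have "card (set ps) \<le> card {?b..<?b + 3 * w}" by (intro card_mono) auto
      then have "card (set ps) \<le> 3 * w" by simp
      then show ?thesis using ps w by (simp add: distinct_card strict_sorted_iff)
    qed (use w in simp)
  next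
    \<comment> \<open>From \<open>3 * w * m\<close> \<le> \<open>n\<close>, at least a third of
      \<open>n\<close> remains, and this is at least \<open>k\<close>.\<close>
    show "k \<le> n - 2 * w * m" using n by simp
  qed (use lo_hi_mono ends between in auto)
qed

lemma block_word_inject:
  assumes "0 < w" "x < w * m"
    and eq: "\<And>p. p < 3 * w * m \<Longrightarrow> block_word w m g p = block_word w m h p"
  shows "g x = h x"
proof -
  obtain i t where it: "i < m" "t < w" "x = w * i + t"
    using assms(2) by (rule block_position_cases)
  then have "block_word w m f (3 * w * i + (w + t)) = w * i + f x" for f
    by (simp add: block_word_in_block)
  moreover have "3 * w * i + (w + t) < 3 * w * m" using it by (intro block_position_less) auto
  ultimately show ?thesis using eq by (metis add_left_imp_eq)
qed

section \<open>The lower bound in terms of \<open>n\<close> and \<open>k\<close>\<close>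

lemma worst_case_comparisons_ge:
  "S \<in> permutations_of_set {1..n} \<Longrightarrow> comparisons T S \<le> worst_case_comparisons n T"
  unfolding worst_case_comparisons_def by (intro Max_ge) auto

theorem theorem27:
  "\<exists>c::real. c > 0 \<and>
     (\<forall>(n::nat) (k::nat) (T :: nat comparison_tree).
        4 \<le> k \<and> real k \<le> real n / 3 \<and> computes_longest_rollercoaster n k T
        \<longrightarrow> real (worst_case_comparisons n T) \<ge> c * (real n * log 2 (real k)))"
proof (intro exI[of _ "1 / 9"] conjI allI impI)
  fix n k :: nat and T :: "nat comparison_tree"
  assume "4 \<le> k \<and> real k \<le> real n / 3 \<and> computes_longest_rollercoaster n k T"
  then have k: "4 \<le> k" "3 * k \<le> n" and T: "computes_longest_rollercoaster n k T" by auto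
  define d where "d = worst_case_comparisons n T"
  \<comment> \<open>The largest \<open>w\<close> with \<open>3 * w < k\<close>; it is positive
    because \<open>4\<close> \<le> \<open>k\<close>.\<close>
  define w where "w = (k - 1) div 3"
  define m where "m = n div (3 * w)"
  define P where "P h = layered_word.perm n (block_word w m h)" for h
  have w: "0 < w" "3 * w < k" using k by (auto simp: w_def)
  have n: "3 * w * m \<le> n" "n < 3 * w * Suc m"
    using w dividend_less_times_div[of "3 * w" n] by (auto simp: m_def)
  \<comment> \<open>Here \<open>n < 3 * w * m + 3 * w\<close>, and \<open>3 * w\<close> is less than
    \<open>k\<close>, which is at most a third of \<open>n\<close>. This is the source of the
    constant \<open>1 / 9\<close>.\<close>
  have wm: "2 * n \<le> 9 * (w * m)" using n(2) w(2) k(2) by simp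
  have layered: "layered_word n (n - 2 * w * m) k (block_lo w m) (block_hi w m) (block_word w m h)"
    if "\<And>x. x < w * m \<Longrightarrow> h x < w" for h
    using w n k that by (intro layered_block_word) auto
  have d: "comparisons T (P h) \<le> d" if "\<And>x. x < w * m \<Longrightarrow> h x < w" for h
    unfolding d_def P_def
    by (intro worst_case_comparisons_ge layered_word.perm_permutation[OF layered] that)
  have "real n * log 2 (real k) \<le> 9 * real d"
  proof (cases "k < 16")
    case True
    \<comment> \<open>Any admissible filling serves here; the constant 0 is one since
      \<open>0 < w\<close>. The \<open>2 * w * m\<close> forced comparisons suffice because the
      logarithm is at most 4.\<close>
    have "n \<le> n - 2 * w * m + comparisons T (P (\<lambda>_. 0))"
      unfolding P_def by (intro layered_word.comparisons_perm_ge[OF layered] T w)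
    then have "n \<le> n - 2 * w * m + d" using d[of "\<lambda>_. 0"] w by simp
    then have "2 * (w * m) \<le> d" using n(1) by simp
    then have "real n * 4 \<le> 9 * real d" using wm by linarith
    moreover have "log 2 (real k) \<le> log 2 (2 ^ 4)" using True k by (intro log_mono) auto
    then have "log 2 (real k) \<le> 4" by (simp only: log_pow_cancel)
    then have "real n * log 2 (real k) \<le> real n * 4" by (intro mult_left_mono) auto
    ultimately show ?thesis by linarith
  next
    case False
    \<comment> \<open>Extensional functions, so that agreement on the \<open>w * m\<close> free
      places means equality and the count is exactly \<open>w ^ (w * m)\<close>.\<close>
    define H where "H = {..<w * m} \<rightarrow>\<^sub>E {..<w}"
    have H: "h x < w" if "h \<in> H" "x < w * m" for h x
      using that by (auto simp: H_def)
    have "inj_on (path T \<circ> P) H"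
    proof (rule inj_onI)
      fix g h assume gh: "g \<in> H" "h \<in> H" "(path T \<circ> P) g = (path T \<circ> P) h"
      then have "block_word w m g p = block_word w m h p" if "p < n" for p
        using path_perm_eqD[OF layered layered T, of g h p] H that by (simp add: P_def)
      then have "g x = h x" if "x < w * m" for x
        using block_word_inject[OF w(1) that] n(1) by simp
      with gh show "g = h" unfolding H_def by (intro PiE_ext) auto
    qed
    then have inj: "inj_on P H" "inj_on (path T) (P ` H)"
      by (blast intro: inj_on_imageI inj_on_imageI2)+
    have "w ^ (w * m) = card (P ` H)"
      using inj(1) by (simp add: card_image H_def card_PiE)
    also have "\<dots> \<le> 2 ^ d"
    proof (rule card_le_if_inj_on_path[OF _ inj(2)])
      show "finite (P ` H)" by (simp add: H_def finite_PiE)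
      show "comparisons T S \<le> d" if "S \<in> P ` H" for S
        using that d H by blast
    qed
    finally have "real w ^ (w * m) \<le> 2 ^ d" by (metis of_nat_le_iff of_nat_numeral of_nat_power)
    then have "log 2 (real w ^ (w * m)) \<le> log 2 (2 ^ d)" using w by (intro log_mono) auto
    then have *: "real (w * m) * log 2 (real w) \<le> real d" using w by (simp add: log_nat_power)
    \<comment> \<open>For \<open>16\<close> \<le> \<open>k\<close>, the bound \<open>k\<close> \<le>
      \<open>w * w\<close> lets \<open>2 * log 2 w\<close> replace \<open>log 2 k\<close>.\<close>
    have "5 \<le> w" "k \<le> 3 * w + 3" using False by (auto simp: w_def)
    then have "k \<le> w * w" using mult_le_mono1[of 5 w w] by linarith
    then have "log 2 (real k) \<le> log 2 (real w ^ 2)"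
      using k by (intro log_mono) (auto simp: power2_eq_square simp flip: of_nat_mult)
    then have "log 2 (real k) \<le> 2 * log 2 (real w)" using w by (simp add: log_nat_power)
    then have "real n * log 2 (real k) \<le> real n * (2 * log 2 (real w))" by (intro mult_left_mono) auto
    also have "\<dots> = real (2 * n) * log 2 (real w)" by simp
    also have "\<dots> \<le> real (9 * (w * m)) * log 2 (real w)"
      using w by (intro mult_right_mono of_nat_mono wm) auto
    also have "\<dots> \<le> 9 * real d" using * by simp
    finally show ?thesis .
  qed
  then show "1 / 9 * (real n * log 2 (real k)) \<le> real (worst_case_comparisons n T)"
    by (simp add: d_def)
qed simp

end
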